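(* Let $n\ge 3$ and let $T$ be a triangulation of a convex $n$-gon with vertices labeled cyclically $1,\dots,n$. Assign a formal weight (independent indeterminate) $x_{i,j}=x_{j,i}$ to each of the $2n-3$ edges of the triangulated $n$-gon (its $n$ sides and the $n-3$ diagonals in $T$), where $x_{i,j}$ is associated with the edge joining vertices $i$ and $j$. Then there is a unique assignment of rational functions $M_{i,j}=M_{j,i}$ in these $2n-3$ indeterminates (over $\mathbf{Q}$) to all $n(n-3)/2$ diagonals of the $n$-gon, with $M_{i,j}=x_{i,j}$ for the diagonals belonging to $T$ (and, by convention, $M_{i,j}=x_{i,j}$ for the sides), such that for any four vertices $i,j,k,l$ of the $n$-gon listed in cyclic order, the rational functions assigned to the four sides and two diagonals of the quadrilateral they determine satisfy the Ptolemy relation $$M_{i,j}\,M_{k,l}+M_{j,k}\,M_{i,l}=M_{i,k}\,M_{j,l}.$$ Moreover, these rational functions of the original $2n-3$ variables are Laurent polynomials with positive coefficients.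
   Context: A triangulation of a convex $n$-gon is a dissection into $n-2$ triangles by $n-3$ pairwise non-crossing diagonals. A Laurent polynomial with positive coefficients is a rational function that can be written as a finite linear combination of monomials with (possibly negative) integer exponents, all of whose non-zero coefficients are positive. *)

theory Defs
  imports
    Complex_Main
    "HOL-Library.Poly_Mapping"
    "HOL-Library.FuncSet"
    "HOL-Library.Nat_Bijection"
    "HOL-Computational_Algebra.Fraction_Field"
begin

text \<open>
  The vertices of the convex \<open>n\<close>-gon are \<open>1, \<dots>, n\<close> in cyclic order; an edge or diagonal
  joining \<open>i\<close> and \<open>j\<close> is the unordered pair \<open>{i, j}\<close>. Only the cyclic order of the vertices
  of a convex polygon matters here.
\<close>

definition chords :: "nat \<Rightarrow> nat set set" where
  "chords n = {{i, j} | i j. i \<in> {1..n} \<and> j \<in> {1..n} \<and> i \<noteq> j}"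

definition sides :: "nat \<Rightarrow> nat set set" where
  "sides n = {{i, i mod n + 1} | i. i \<in> {1..n}}"

definition diagonals :: "nat \<Rightarrow> nat set set" where
  "diagonals n = chords n - sides n"

definition cyclic_order :: "nat \<Rightarrow> nat \<Rightarrow> nat \<Rightarrow> nat \<Rightarrow> nat \<Rightarrow> bool" where
  "cyclic_order n i j k l \<longleftrightarrow>
     {i, j, k, l} \<subseteq> {1..n} \<and>
     (i < j \<and> j < k \<and> k < l \<or> j < k \<and> k < l \<and> l < i \<or>
      k < l \<and> l < i \<and> i < j \<or> l < i \<and> i < j \<and> j < k)"

text \<open>
  In a convex polygon two diagonals meet in their interiors iff they are the two diagonals
  of a quadrilateral spanned by four vertices.
\<close>

definition crossing :: "nat \<Rightarrow> nat set \<Rightarrow> nat set \<Rightarrow> bool" where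
  "crossing n d d' \<longleftrightarrow> (\<exists>i j k l. cyclic_order n i j k l \<and> d = {i, k} \<and> d' = {j, l})"

text \<open>
  Pairwise non-crossing diagonals, \<open>n - 3\<close> in number, cut the polygon into \<open>n - 2\<close> pieces, and
  counting sides shows that all the pieces are triangles.
\<close>

definition triangulation :: "nat \<Rightarrow> nat set set \<Rightarrow> bool" where
  "triangulation n T \<longleftrightarrow>
     T \<subseteq> diagonals n \<and> card T = n - 3 \<and> (\<forall>d\<in>T. \<forall>d'\<in>T. \<not> crossing n d d')"

definition triangulation_edges :: "nat \<Rightarrow> nat set set \<Rightarrow> nat set set" where
  "triangulation_edges n T = sides n \<union> T"

text \<open>
  Polynomials over the rationals in indeterminates numbered by \<open>nat\<close>, the exponent vectors being
  finitely supported functions, and the field of fractions of this polynomial ring. The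
  index type has to be linearly ordered for the ring to be an instance of \<open>idom\<close>, hence
  unordered pairs are numbered by the injection \<open>set_encode\<close> on finite sets of naturals.
\<close>

lemma inj_on_set_encode_chords: "inj_on set_encode (chords n)"
  by (rule inj_on_subset[OF inj_on_set_encode]) (auto simp: chords_def)

type_synonym polynomial = "(nat \<Rightarrow>\<^sub>0 nat) \<Rightarrow>\<^sub>0 rat"

type_synonym ratfun = "polynomial fract"

definition const :: "rat \<Rightarrow> ratfun" where
  "const c = Fract (Poly_Mapping.single 0 c) 1"

definition indet :: "nat set \<Rightarrow> ratfun" where
  "indet e = Fract (Poly_Mapping.single (Poly_Mapping.single (set_encode e) 1) 1) 1"

definition polynomials_in :: "nat set set \<Rightarrow> polynomial set" where
  "polynomials_in E = {p. \<forall>m\<in>Poly_Mapping.keys p. Poly_Mapping.keys m \<subseteq> set_encode ` E}"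

definition ratfuns_in :: "nat set set \<Rightarrow> ratfun set" where
  "ratfuns_in E = {Fract p q | p q. p \<in> polynomials_in E \<and> q \<in> polynomials_in E \<and> q \<noteq> 0}"

text \<open>
  The finitely supported function \<open>L\<close> lists the coefficients of a Laurent polynomial; its keys are
  the integer exponent vectors of the monomials that occur, so its values there are
  the non-zero coefficients.
\<close>

definition positive_laurent :: "nat set set \<Rightarrow> ratfun \<Rightarrow> bool" where
  "positive_laurent E f \<longleftrightarrow>
     (\<exists>L :: (nat set \<Rightarrow>\<^sub>0 int) \<Rightarrow>\<^sub>0 rat.
        (\<forall>a\<in>Poly_Mapping.keys L. Poly_Mapping.keys a \<subseteq> E \<and> Poly_Mapping.lookup L a > 0) \<and>
        f = (\<Sum>a\<in>Poly_Mapping.keys L. const (Poly_Mapping.lookup L a) *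
               (\<Prod>e\<in>Poly_Mapping.keys a. indet e powi Poly_Mapping.lookup a e)))"

text \<open>
  The assignment is an extensional function on the unordered pairs of distinct vertices, so that
  equality of assignments is equality on the sides (where it is prescribed) and the diagonals.
\<close>

definition ptolemy_assignment :: "nat \<Rightarrow> nat set set \<Rightarrow> (nat set \<Rightarrow> ratfun) \<Rightarrow> bool" where
  "ptolemy_assignment n T M \<longleftrightarrow>
     M \<in> chords n \<rightarrow>\<^sub>E ratfuns_in (triangulation_edges n T) \<and>
     (\<forall>e\<in>triangulation_edges n T. M e = indet e) \<and>
     (\<forall>i j k l. cyclic_order n i j k l \<longrightarrow>
        M {i, j} * M {k, l} + M {j, k} * M {i, l} = M {i, k} * M {j, l})"

end

theory Submission
  imports Defs
begin

text \<open>
  The triangle over an edge \<open>{a, b}\<close> with apex \<open>m\<close> in the interval \<open>(a, b)\<close> lets one fill up the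
  vertex set \<open>{1..n}\<close> from \<open>{1, n}\<close>, adding one apex at a time between two neighbours. The new
  vertex \<open>m\<close> enters the Ptolemy relations \<open>M {i, m} * x {a, b} = x {a, m} * M {b, i} + x {m, b} * M {a, i}\<close>,
  which divide by an indeterminate only: this gives uniqueness and positivity. For existence,
  choose vectors in the plane with \<open>det (v a) (v b) = x {a, b}\<close>, put
  \<open>v m = (x {m, b} * v a + x {a, m} * v b) / x {a, b}\<close>, and let \<open>M {i, j} = det (v i) (v j)\<close> for
  \<open>i < j\<close>; the Ptolemy relations are then the Pluecker relations.
\<close>

section \<open>Triangulations\<close>

lemma pair_in_chords: "i \<in> {1..n} \<Longrightarrow> j \<in> {1..n} \<Longrightarrow> i \<noteq> j \<Longrightarrow> {i, j} \<in> chords n"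
  by (auto simp: chords_def)

text \<open>
  An arc \<open>(i, j)\<close> is sent to the largest \<open>m < j\<close> such that \<open>m = i + 1\<close> or \<open>(i, m)\<close> is an arc;
  non-crossing makes this injective.
\<close>

lemma card_noncrossing_arcs_le:
  fixes D :: "(nat \<times> nat) set"
  assumes D: "\<And>i j. (i, j) \<in> D \<Longrightarrow> a \<le> i \<and> i + 2 \<le> j \<and> j \<le> b"
    and nc: "\<And>i j k l. (i, j) \<in> D \<Longrightarrow> (k, l) \<in> D \<Longrightarrow> \<not> (i < k \<and> k < j \<and> j < l)"
  shows "card D \<le> b - a - 1"
proof -
  define C where "C i j = {m. i < m \<and> m < j \<and> (m = i + 1 \<or> (i, m) \<in> D)}" for i j
  define f where "f = (\<lambda>(i, j). Max (C i j))"
  have fin: "finite (C i j)" for i j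
    by (rule finite_subset[of _ "{..<j}"]) (auto simp: C_def)
  have f: "f (i, j) \<in> C i j" if "(i, j) \<in> D" for i j
  proof -
    have "i + 1 \<in> C i j" using D[OF that] by (auto simp: C_def)
    with fin show ?thesis unfolding f_def by (simp, intro Max_in) auto
  qed
  have f_ge: "m \<le> f (i, j)" if "m \<in> C i j" for m i j
    using fin that by (simp add: f_def)
  have "inj_on f D"
  proof -
    have clash: False
      if p: "(i, j) \<in> D" "(k, l) \<in> D" and eq: "f (i, j) = f (k, l)"
        and less: "i < k \<or> i = k \<and> j < l" for i j k l
    proof -
      have m: "f (i, j) \<in> C i j" "f (i, j) \<in> C k l" using f[OF p(1)] f[OF p(2)] eq by simp_all
      show False
      proof (cases "i < k")
        case True
        \<comment> \<open>Since \<open>f (i, j)\<close> lies in \<open>C k l\<close>, it exceeds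
          \<open>k\<close>, so it is not \<open>i + 1\<close> and must come from an arc. That arc
          crosses \<open>(k, l)\<close>.\<close>
        with m have "(i, f (i, j)) \<in> D" by (auto simp: C_def)
        with nc[OF this p(2)] True m show False by (auto simp: C_def)
      next
        case False
        \<comment> \<open>For a common left end, the shorter arc makes \<open>j\<close> itself a
          candidate for \<open>(k, l)\<close>, so the maximum there is at least \<open>j\<close>,
          while \<open>f (i, j) < j\<close>.\<close>
        with less have "j \<in> C k l" using p D[OF p(1)] by (auto simp: C_def)
        from f_ge[OF this] eq m show False by (auto simp: C_def)
      qed
    qed
    have "i = k \<and> j = l"
      if "(i, j) \<in> D" "(k, l) \<in> D" "f (i, j) = f (k, l)" for i j k l
    proof (rule ccontr)
      assume "\<not> (i = k \<and> j = l)"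
      then have "(i < k \<or> i = k \<and> j < l) \<or> (k < i \<or> k = i \<and> l < j)" by linarith
      then show False
        using clash[OF that] clash[OF that(2,1) that(3)[symmetric]] by blast
    qed
    then show ?thesis by (force simp: inj_on_def)
  qed
  moreover have "f ` D \<subseteq> {a<..<b}"
    using f D by (fastforce simp: C_def)
  ultimately have "card D \<le> card {a<..<b}"
    by (intro card_inj_on_le) auto
  then show ?thesis by simp
qed

section \<open>Edges and triangles of a fixed triangulation\<close>

locale triangulated_polygon =
  fixes n :: nat and T :: "nat set set"
  assumes n: "n \<ge> 3" and T: "triangulation n T"
begin

abbreviation E :: "nat set set" where "E \<equiv> triangulation_edges n T"

text \<open>The wrap-around in \<open>k mod n + 1\<close> matters only at \<open>k = n\<close>,
  where it produces the closing side. This translates the cyclic description into the linear order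
  on \<open>{1..n}\<close>.\<close>

lemma side_iff:
  assumes "i < j" "i \<in> {1..n}" "j \<in> {1..n}"
  shows "{i, j} \<in> sides n \<longleftrightarrow> j = i + 1 \<or> i = 1 \<and> j = n"
proof
  assume "{i, j} \<in> sides n"
  then obtain k where k: "k \<in> {1..n}" "{i, j} = {k, k mod n + 1}"
    by (auto simp: sides_def)
  show "j = i + 1 \<or> i = 1 \<and> j = n"
  proof (cases "k = n")
    case True
    with k n assms show ?thesis by (auto simp: doubleton_eq_iff)
  next
    case False
    with k have "k mod n = k" by auto
    with k assms show ?thesis by (auto simp: doubleton_eq_iff)
  qed
next
  assume "j = i + 1 \<or> i = 1 \<and> j = n"
  then show "{i, j} \<in> sides n"
  proof
    assume "j = i + 1"
    with assms have "{i, j} = {i, i mod n + 1}" by auto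
    with assms show ?thesis unfolding sides_def by blast
  next
    assume "i = 1 \<and> j = n"
    then have "{i, j} = {n, n mod n + 1}" by auto
    with n show ?thesis unfolding sides_def by fastforce
  qed
qed

lemma sides_subset_chords: "sides n \<subseteq> chords n"
proof
  fix e assume "e \<in> sides n"
  then obtain k where k: "k \<in> {1..n}" "e = {k, k mod n + 1}"
    by (auto simp: sides_def)
  moreover have "k mod n + 1 \<in> {1..n}" "k \<noteq> k mod n + 1"
    using k(1) n by (cases "k = n"; auto simp: Suc_le_eq)+
  ultimately show "e \<in> chords n" unfolding chords_def by blast
qed

lemma edges_subset_chords: "E \<subseteq> chords n"
  using sides_subset_chords T by (auto simp: triangulation_edges_def triangulation_def diagonals_def)

lemma side_edge:
  assumes "i < j" "i \<in> {1..n}" "j \<in> {1..n}" "j = i + 1 \<or> i = 1 \<and> j = n"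
  shows "{i, j} \<in> E"
  using side_iff assms by (auto simp: triangulation_edges_def)

text \<open>Strict interleaving leaves a vertex between the ends of each edge and excludes
  \<open>{1, n}\<close>, so neither edge is a side; both are then in \<open>T\<close>.\<close>

lemma edges_noncrossing:
  assumes "{i, j} \<in> E" "{k, l} \<in> E" "i < k" "k < j" "j < l" "i \<in> {1..n}" "l \<in> {1..n}"
  shows False
proof -
  have "{i, j} \<in> T" "{k, l} \<in> T"
    using assms side_iff[of i j] side_iff[of k l] by (auto simp: triangulation_edges_def)
  moreover have "crossing n {i, j} {k, l}"
    unfolding crossing_def cyclic_order_def using assms
    by (intro exI[of _ i] exI[of _ k] exI[of _ j] exI[of _ l]) auto
  ultimately show False using T by (auto simp: triangulation_def)
qed

text \<open>Adding one more arc to \<open>T\<close> and \<open>{1, n}\<close> would exceed the bound on non-crossing arcs.\<close>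

lemma nonedge_crossed:
  assumes ij: "i < j" "i \<in> {1..n}" "j \<in> {1..n}" and not_edge: "{i, j} \<notin> E"
  shows "\<exists>k l. k \<in> {1..n} \<and> l \<in> {1..n} \<and> {k, l} \<in> E \<and> (k < i \<and> i < l \<and> l < j \<or> i < k \<and> k < j \<and> j < l)"
proof (rule ccontr)
  assume uncrossed: "\<not> ?thesis"
  define D where "D = {(k, l). k < l \<and> {k, l} \<in> T}"
  have D_bounds: "1 \<le> k \<and> k + 2 \<le> l \<and> l \<le> n \<and> \<not> (k = 1 \<and> l = n)" if "(k, l) \<in> D" for k l
  proof -
    have kl: "k < l" "{k, l} \<in> chords n" "{k, l} \<notin> sides n"
      using that T by (auto simp: D_def triangulation_def diagonals_def)
    then have "k \<in> {1..n}" "l \<in> {1..n}" by (auto simp: chords_def doubleton_eq_iff)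
    with kl side_iff[of k l] show ?thesis by auto
  qed
  have D_finite: "finite D"
    by (rule finite_subset[of _ "{1..n} \<times> {1..n}"]) (use D_bounds in fastforce)+
  have D_edge: "{k, l} \<in> E" if "(k, l) \<in> D" for k l
    using that by (auto simp: D_def triangulation_edges_def)
  have "T = (\<lambda>(k, l). {k, l}) ` D"
  proof (intro equalityI subsetI)
    fix d assume d: "d \<in> T"
    then obtain k l where kl: "d = {k, l}" "k \<noteq> l"
      using T by (auto simp: triangulation_def diagonals_def chords_def)
    show "d \<in> (\<lambda>(k, l). {k, l}) ` D"
    proof (cases "k < l")
      case True
      with d kl have "(k, l) \<in> D" by (auto simp: D_def)
      with kl show ?thesis by force
    next
      case False
      with d kl have "(l, k) \<in> D" by (auto simp: D_def insert_commute)
      with kl show ?thesis by (force simp: insert_commute)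
    qed
  qed (auto simp: D_def)
  moreover have "inj_on (\<lambda>(k, l). {k, l}) D"
    by (auto simp: inj_on_def D_def doubleton_eq_iff)
  ultimately have "card D = n - 3"
    using T by (metis card_image triangulation_def)
  moreover have "(i, j) \<notin> D" "(1, n) \<notin> D" "(i, j) \<noteq> (1, n)"
    using D_edge D_bounds not_edge side_edge[OF ij] by auto
  ultimately have "card (insert (i, j) (insert (1, n) D)) = n - 1"
    using D_finite n by simp
  moreover have "card (insert (i, j) (insert (1, n) D)) \<le> n - 1 - 1"
  proof (rule card_noncrossing_arcs_le)
    have ij2: "i + 2 \<le> j" using not_edge ij(1) side_edge[OF ij] by (cases "j = i + 1") auto
    show bounds: "1 \<le> k \<and> k + 2 \<le> l \<and> l \<le> n" if "(k, l) \<in> insert (i, j) (insert (1, n) D)" for k l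
      using that D_bounds n ij ij2 by auto
    show "\<not> (p < k \<and> k < q \<and> q < l)"
      if arcs: "(p, q) \<in> insert (i, j) (insert (1, n) D)" "(k, l) \<in> insert (i, j) (insert (1, n) D)"
      for p q k l
    proof
      assume less: "p < k \<and> k < q \<and> q < l"
      have rng: "p \<in> {1..n}" "q \<in> {1..n}" "k \<in> {1..n}" "l \<in> {1..n}"
        using bounds[OF arcs(1)] bounds[OF arcs(2)] by auto
      \<comment> \<open>The arc \<open>(1, n)\<close> encloses all vertices and crosses nothing, and
        no arc crosses itself. What remains is two arcs of \<open>D\<close>, or
        \<open>(i, j)\<close> against one of them.\<close>
      then have "(p, q) \<noteq> (1, n)" "(k, l) \<noteq> (1, n)" "(p, q) \<noteq> (k, l)" using less by auto
      then consider "(p, q) \<in> D" "(k, l) \<in> D" | "(p, q) = (i, j)" "(k, l) \<in> D"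
        | "(p, q) \<in> D" "(k, l) = (i, j)"
        using arcs by blast
      then show False
      proof cases
        case 1
        with edges_noncrossing[of p q k l] D_edge less rng show False by auto
      next
        case 2
        with uncrossed D_edge less rng show False by blast
      next
        case 3
        with uncrossed D_edge less rng show False by blast
      qed
    qed
  qed
  ultimately show False using n by simp
qed

text \<open>The apex is the largest neighbour \<open>m\<close> of \<open>a\<close> below
  \<open>b\<close>. If \<open>{m, b}\<close> were not an edge, some edge would cross it; that edge
  would also cross \<open>{a, m}\<close> or \<open>{a, b}\<close>, or else give a larger neighbour
  of \<open>a\<close>.\<close>

lemma triangle_over_edge:
  assumes ab: "{a, b} \<in> E" "a + 2 \<le> b" "a \<in> {1..n}" "b \<in> {1..n}"
  obtains m where "a < m" "m < b" "{a, m} \<in> E" "{m, b} \<in> E"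
proof -
  define C where "C = {m. a < m \<and> m < b \<and> {a, m} \<in> E}"
  define m where "m = Max C"
  have fin: "finite C"
    by (rule finite_subset[of _ "{..<b}"]) (auto simp: C_def)
  have "a + 1 \<in> C" using ab side_edge[of a "a + 1"] by (auto simp: C_def)
  with fin have m: "m \<in> C" unfolding m_def by (intro Max_in) auto
  have "{m, b} \<in> E"
  proof (rule ccontr)
    assume "{m, b} \<notin> E"
    moreover have "m < b" "m \<in> {1..n}" using m ab by (auto simp: C_def)
    ultimately obtain k l where kl: "k \<in> {1..n}" "l \<in> {1..n}" "{k, l} \<in> E"
      and "k < m \<and> m < l \<and> l < b \<or> m < k \<and> k < b \<and> b < l"
      using nonedge_crossed[of m b] ab by auto
    then show False
    proof (elim disjE)
      assume less: "k < m \<and> m < l \<and> l < b"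
      consider "k < a" | "k = a" | "a < k" by linarith
      then show False
      proof cases
        case 1
        with edges_noncrossing[of k l a b] less m kl ab show False by (auto simp: C_def)
      next
        case 2
        with less m kl have "l \<in> C" by (auto simp: C_def)
        with fin have "l \<le> m" by (simp add: m_def)
        with less show False by simp
      next
        case 3
        with edges_noncrossing[of a m k l] less m kl ab show False by (auto simp: C_def)
      qed
    next
      assume "m < k \<and> k < b \<and> b < l"
      with edges_noncrossing[of a b k l] m kl ab show False by (auto simp: C_def)
    qed
  qed
  with m that show thesis by (auto simp: C_def)
qed

text \<open>The hidden invariant is that neighbouring elements of \<open>S\<close> are joined by an
  edge. Hence every gap has a triangle over it, whose apex can be added next.\<close>

lemma vertex_filling_induct [consumes 0, case_names base step]:
  assumes base: "P {1, n}"
    and step: "\<And>S a b m. \<lbrakk>P S; S \<subseteq> {1..n}; a \<in> S; b \<in> S; a < m; m < b;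
      \<And>s. s \<in> S \<Longrightarrow> s \<le> a \<or> b \<le> s; {a, b} \<in> E; {a, m} \<in> E; {m, b} \<in> E\<rbrakk> \<Longrightarrow> P (insert m S)"
  shows "P {1..n}"
proof -
  have filled: "P {1..n}"
    if "P S" "S \<subseteq> {1..n}" "1 \<in> S" "n \<in> S"
      and "\<And>a b. \<lbrakk>a \<in> S; b \<in> S; a < b; \<And>s. s \<in> S \<Longrightarrow> s \<le> a \<or> b \<le> s\<rbrakk> \<Longrightarrow> {a, b} \<in> E" for S
    using that
  proof (induction "card ({1..n} - S)" arbitrary: S rule: less_induct)
    case less
    show ?case
    proof (cases "S = {1..n}")
      case True
      with less.prems show ?thesis by simp
    next
      case False
      with less.prems obtain v where v: "v \<in> {1..n}" "v \<notin> S" by blast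
      \<comment> \<open>The missing vertex \<open>v\<close> only locates a gap \<open>(a, b)\<close>
        of \<open>S\<close>. The vertex added is the apex over \<open>{a, b}\<close>, which may
        differ from \<open>v\<close>.\<close>
      define a where "a = Max {s \<in> S. s < v}"
      define b where "b = Min {s \<in> S. v < s}"
      have fin: "finite S" using less.prems(2) finite_subset by blast
      have "1 \<noteq> v" "n \<noteq> v" using v less.prems by auto
      then have ne: "1 \<in> {s \<in> S. s < v}" "n \<in> {s \<in> S. v < s}"
        using v less.prems by auto
      have "a \<in> {s \<in> S. s < v}" unfolding a_def using fin ne by (intro Max_in) auto
      then have a: "a \<in> S" "a < v" by auto
      have "b \<in> {s \<in> S. v < s}" unfolding b_def using fin ne by (intro Min_in) auto
      then have b: "b \<in> S" "v < b" by auto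
      have gap: "s \<le> a \<or> b \<le> s" if "s \<in> S" for s
      proof -
        have "s < v \<or> v < s" using that v by (metis linorder_neqE_nat)
        then show ?thesis using fin that by (auto simp: a_def b_def)
      qed
      have ab: "{a, b} \<in> E" using less.prems(5) a b gap by auto
      obtain m where m: "a < m" "m < b" "{a, m} \<in> E" "{m, b} \<in> E"
      proof (rule triangle_over_edge[OF ab])
        show "a + 2 \<le> b" using a b by simp
        show "a \<in> {1..n}" "b \<in> {1..n}" using a b less.prems(2) by auto
      qed
      have m_new: "m \<notin> S" using gap[of m] m by auto
      have m_rng: "m \<in> {1..n}" using m a b less.prems(2) by fastforce
      show ?thesis
      proof (rule less.hyps[of "insert m S"])
        show "card ({1..n} - insert m S) < card ({1..n} - S)"
        proof (rule psubset_card_mono)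
          show "{1..n} - insert m S \<subset> {1..n} - S" using m_new m_rng by blast
        qed simp
        show "P (insert m S)"
          using step[OF less.prems(1,2) a(1) b(1) m(1,2) gap ab m(3,4)] .
        show "{p, q} \<in> E"
          if pq: "p \<in> insert m S" "q \<in> insert m S" "p < q"
            and gap': "\<And>s. s \<in> insert m S \<Longrightarrow> s \<le> p \<or> q \<le> s" for p q
        proof -
          \<comment> \<open>Inserting \<open>m\<close> creates only the neighbouring pairs
            \<open>(a, m)\<close> and \<open>(m, b)\<close>, the two new sides of the
            triangle.\<close>
          consider "p = m" "q \<in> S" | "q = m" "p \<in> S" | "p \<in> S" "q \<in> S" using pq by auto
          then show ?thesis
          proof cases
            case 1
            then have "q = b" using gap[of q] gap'[of b] b m pq by auto
            with 1 m show ?thesis by simp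
          next
            case 2
            then have "p = a" using gap[of p] gap'[of a] a m pq by auto
            with 2 m show ?thesis by simp
          next
            case 3
            then show ?thesis using less.prems(5) pq gap' by auto
          qed
        qed
      qed (use less.prems m_rng in auto)
    qed
  qed
  show ?thesis
  proof (rule filled[OF base])
    show "{a, b} \<in> E" if "a \<in> {1, n}" "b \<in> {1, n}" "a < b" for a b
      using that n by (intro side_edge) auto
  qed (use n in auto)
qed

section \<open>Ptolemy relations over a field\<close>

text \<open>An arbitrary field suffices for the combinatorial part, where the edge values only have
  to be nonzero.\<close>

definition ptolemy :: "(nat set \<Rightarrow> 'a::field) \<Rightarrow> bool" where
  "ptolemy M \<longleftrightarrow> (\<forall>i j k l. cyclic_order n i j k l \<longrightarrow>
     M {i, j} * M {k, l} + M {j, k} * M {i, l} = M {i, k} * M {j, l})"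

text \<open>This is the relation for the quadrilateral on \<open>i\<close>, \<open>a\<close>,
  \<open>m\<close>, \<open>b\<close>, solved for one diagonal; the two positions of \<open>i\<close>
  give two rotations of the same cyclic order.\<close>

lemma ptolemy_apex:
  fixes M :: "nat set \<Rightarrow> 'a::field"
  assumes M: "ptolemy M" "M {a, b} \<noteq> 0"
    and amb: "a < m" "m < b" "a \<in> {1..n}" "b \<in> {1..n}"
    and i: "i \<in> {1..n}" "i < a \<or> b < i"
  shows "M {i, m} = (M {a, m} * M {i, b} + M {m, b} * M {i, a}) * inverse (M {a, b})"
proof -
  have "M {a, m} * M {i, b} + M {m, b} * M {i, a} = M {i, m} * M {a, b}"
  proof (cases "i < a")
    case True
    then have "cyclic_order n i a m b" using amb i by (auto simp: cyclic_order_def)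
    with M(1) have "M {i, a} * M {m, b} + M {a, m} * M {i, b} = M {i, m} * M {a, b}"
      by (simp add: ptolemy_def)
    then show ?thesis by (simp add: mult.commute add.commute)
  next
    case False
    then have "cyclic_order n a m b i" using amb i by (auto simp: cyclic_order_def)
    with M(1) have "M {a, m} * M {b, i} + M {m, b} * M {a, i} = M {a, b} * M {m, i}"
      by (simp add: ptolemy_def)
    then show ?thesis by (simp add: mult.commute insert_commute)
  qed
  with M(2) show ?thesis by (simp add: field_simps)
qed

text \<open>Along the filling, \<open>ptolemy_apex\<close> computes each value at the new vertex
  from edge values and from values already known to agree.\<close>

lemma ptolemy_unique:
  fixes M N :: "nat set \<Rightarrow> 'a::field"
  assumes M: "ptolemy M" and N: "ptolemy N"
    and eq: "\<And>e. e \<in> E \<Longrightarrow> M e = N e" and nz: "\<And>e. e \<in> E \<Longrightarrow> N e \<noteq> 0"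
    and d: "d \<in> chords n"
  shows "M d = N d"
proof -
  have "\<forall>i\<in>{1..n}. \<forall>j\<in>{1..n}. i \<noteq> j \<longrightarrow> M {i, j} = N {i, j}"
  proof (induction rule: vertex_filling_induct)
    case base
    have "{1, n} \<in> E" using n side_edge[of 1 n] by auto
    with eq show ?case by (auto simp: insert_commute)
  next
    case (step S a b m)
    have im: "M {i, m} = N {i, m}" if i: "i \<in> S" "i \<noteq> m" for i
    proof (cases "i = a \<or> i = b")
      case True
      then show ?thesis using eq step.hyps by (auto simp: insert_commute)
    next
      case False
      \<comment> \<open>No element of \<open>S\<close> lies strictly between \<open>a\<close> and
        \<open>b\<close>, so an old vertex other than these two lies outside the gap.\<close>
      with step.hyps i have i': "i \<in> {1..n}" "i < a \<or> b < i" "a \<in> {1..n}" "b \<in> {1..n}"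
        by fastforce+
      show ?thesis
        using step i i' False eq nz ptolemy_apex[OF M, of a b m i] ptolemy_apex[OF N, of a b m i]
        by simp
    qed
    show ?case
    proof (intro ballI impI)
      fix i j assume "i \<in> insert m S" "j \<in> insert m S" "i \<noteq> j"
      then show "M {i, j} = N {i, j}"
        using im[of i] im[of j] step.IH by (auto simp: insert_commute)
    qed
  qed
  with d show ?thesis by (auto simp: chords_def)
qed

text \<open>The recursion of \<open>ptolemy_apex\<close> never subtracts and inverts only edge
  values. With \<open>A\<close> left open, one induction yields both membership in
  \<open>ratfuns_in E\<close> and positivity.\<close>

lemma ptolemy_closed:
  fixes M :: "nat set \<Rightarrow> 'a::field"
  assumes M: "ptolemy M" "\<And>e. e \<in> E \<Longrightarrow> M e \<noteq> 0"
    and edge: "\<And>e. e \<in> E \<Longrightarrow> M e \<in> A" "\<And>e. e \<in> E \<Longrightarrow> inverse (M e) \<in> A"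
    and add: "\<And>x y. x \<in> A \<Longrightarrow> y \<in> A \<Longrightarrow> x + y \<in> A"
    and mult: "\<And>x y. x \<in> A \<Longrightarrow> y \<in> A \<Longrightarrow> x * y \<in> A"
    and d: "d \<in> chords n"
  shows "M d \<in> A"
proof -
  have "\<forall>i\<in>{1..n}. \<forall>j\<in>{1..n}. i \<noteq> j \<longrightarrow> M {i, j} \<in> A"
  proof (induction rule: vertex_filling_induct)
    case base
    have "{1, n} \<in> E" using n side_edge[of 1 n] by auto
    with edge show ?case by (auto simp: insert_commute)
  next
    case (step S a b m)
    have im: "M {i, m} \<in> A" if i: "i \<in> S" "i \<noteq> m" for i
    proof (cases "i = a \<or> i = b")
      case True
      then show ?thesis using edge step.hyps by (auto simp: insert_commute)
    next
      case False
      with step.hyps i have i': "i \<in> {1..n}" "i < a \<or> b < i" "a \<in> {1..n}" "b \<in> {1..n}"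
        by fastforce+
      have "M {i, m} = (M {a, m} * M {i, b} + M {m, b} * M {i, a}) * inverse (M {a, b})"
        using ptolemy_apex[OF M(1)] M(2) step.hyps i' by auto
      moreover have "M {i, a} \<in> A" "M {i, b} \<in> A" using step.IH step.hyps i False by auto
      ultimately show ?thesis using edge step.hyps by (auto intro!: add mult)
    qed
    show ?case
    proof (intro ballI impI)
      fix i j assume "i \<in> insert m S" "j \<in> insert m S" "i \<noteq> j"
      then show "M {i, j} \<in> A"
        using im[of i] im[of j] step.IH by (auto simp: insert_commute)
    qed
  qed
  with d show ?thesis by (auto simp: chords_def)
qed

text \<open>A new vertex \<open>m\<close> is joined to \<open>S\<close> only through
  \<open>a\<close> and \<open>b\<close>, since any other edge would cross \<open>{a, b}\<close>. Its
  vector thus has just two determinants to match.\<close>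

lemma plane_vectors_exist:
  fixes x :: "nat set \<Rightarrow> 'a::field"
  assumes nz: "\<And>e. e \<in> E \<Longrightarrow> x e \<noteq> 0"
  shows "\<exists>u v :: nat \<Rightarrow> 'a. \<forall>i\<in>{1..n}. \<forall>j\<in>{1..n}. i < j \<longrightarrow> {i, j} \<in> E \<longrightarrow>
    u i * v j - u j * v i = x {i, j}"
proof (induction rule: vertex_filling_induct)
  case base
  show ?case
    \<comment> \<open>The starting vectors are \<open>(1, 0)\<close> at vertex 1 and
      \<open>(0, x {1, n})\<close> at vertex \<open>n\<close>.\<close>
    by (rule exI[of _ "\<lambda>i. if i = 1 then 1 else 0"], rule exI[of _ "\<lambda>i. if i = 1 then 0 else x {1, n}"])
      (use n in auto)
next
  case (step S a b m)
  from step.IH obtain u v where uv: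
    "\<And>i j. \<lbrakk>i \<in> S; j \<in> S; i < j; {i, j} \<in> E\<rbrakk> \<Longrightarrow> u i * v j - u j * v i = x {i, j}" by blast
  have m_new: "m \<notin> S" using step.hyps(4-6) leD by blast
  \<comment> \<open>Cramer's rule: pairing the new vector with that of \<open>b\<close> leaves only
    the \<open>c\<close> term, pairing with that of \<open>a\<close> only the \<open>d\<close> term,
    each times \<open>x {a, b}\<close>.\<close>
  define c d where "c = x {m, b} / x {a, b}" and "d = x {a, m} / x {a, b}"
  define u' where "u' = u(m := c * u a + d * u b)"
  define v' where "v' = v(m := c * v a + d * v b)"
  have ab: "u a * v b - u b * v a = x {a, b}" and xab: "x {a, b} \<noteq> 0"
    using uv step.hyps nz by auto
  have rng: "a \<in> {1..n}" "b \<in> {1..n}" using step.hyps by auto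
  have "u' i * v' j - u' j * v' i = x {i, j}"
    if ij: "i \<in> insert m S" "j \<in> insert m S" "i < j" "{i, j} \<in> E" for i j
  proof -
    consider "i = m" "j \<in> S" | "j = m" "i \<in> S" | "i \<in> S" "j \<in> S" using ij by auto
    then show ?thesis
    proof cases
      case 1
      have "j = b"
      proof (rule ccontr)
        assume "j \<noteq> b"
        with 1 ij step.hyps have "b < j" "j \<in> {1..n}" by fastforce+
        with edges_noncrossing[of a b m j] 1 ij step.hyps rng show False by auto
      qed
      moreover have "u' m * v' b - u' b * v' m = c * (u a * v b - u b * v a)"
        using step.hyps by (simp add: u'_def v'_def algebra_simps)
      ultimately show ?thesis using 1 ab xab by (simp add: c_def)
    next
      case 2
      have "i = a"
      proof (rule ccontr)
        assume "i \<noteq> a"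
        with 2 ij step.hyps have "i < a" "i \<in> {1..n}" by fastforce+
        with edges_noncrossing[of i m a b] 2 ij step.hyps rng show False by auto
      qed
      moreover have "u' a * v' m - u' m * v' a = d * (u a * v b - u b * v a)"
        using step.hyps by (simp add: u'_def v'_def algebra_simps)
      ultimately show ?thesis using 2 ab xab by (simp add: d_def)
    next
      case 3
      then show ?thesis using uv ij m_new by (auto simp: u'_def v'_def)
    qed
  qed
  then show ?case by blast
qed

lemma ptolemy_exists:
  fixes x :: "nat set \<Rightarrow> 'a::field"
  assumes nz: "\<And>e. e \<in> E \<Longrightarrow> x e \<noteq> 0"
  obtains M :: "nat set \<Rightarrow> 'a" where "ptolemy M" "\<And>e. e \<in> E \<Longrightarrow> M e = x e"
proof -
  obtain u v :: "nat \<Rightarrow> 'a" where uv: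
    "\<And>i j. \<lbrakk>i \<in> {1..n}; j \<in> {1..n}; i < j; {i, j} \<in> E\<rbrakk> \<Longrightarrow> u i * v j - u j * v i = x {i, j}"
    using plane_vectors_exist[of x] nz by blast
  \<comment> \<open>\<open>Min\<close> and \<open>Max\<close> fix the sign of the determinant on an
    unordered pair.\<close>
  define M where "M d = u (Min d) * v (Max d) - u (Max d) * v (Min d)" for d
  have M1: "M {i, j} = u i * v j - u j * v i" if "i < j" for i j
    using that by (simp add: M_def)
  have M2: "M {i, j} = u j * v i - u i * v j" if "j < i" for i j
    using that by (simp add: M_def)
  show thesis
  proof
    show "ptolemy M"
      \<comment> \<open>Each of the four linear orders behind a cyclic order gives, after orienting
        all pairs by \<open>M1\<close> and \<open>M2\<close>, the same Pluecker identity.\<close>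
      unfolding ptolemy_def cyclic_order_def
      by (auto simp: M1 M2 algebra_simps)
    fix e assume e: "e \<in> E"
    then obtain i j where ij: "e = {i, j}" "i < j" "i \<in> {1..n}" "j \<in> {1..n}"
      using edges_subset_chords unfolding chords_def
      by (smt (verit) insert_commute linorder_neqE_nat mem_Collect_eq subsetD)
    with e uv show "M e = x e" by (simp add: M1)
  qed
qed

end

section \<open>Rational functions and positive Laurent polynomials\<close>

lemma indet_nonzero: "indet e \<noteq> 0"
proof -
  have "Poly_Mapping.keys (Poly_Mapping.single (Poly_Mapping.single (set_encode e) 1) 1 :: polynomial) \<noteq> {}"
    by simp
  then have "(Poly_Mapping.single (Poly_Mapping.single (set_encode e) 1) 1 :: polynomial) \<noteq> 0"
    by (metis keys_zero)
  then show ?thesis by (simp only: indet_def Zero_fract_def) (simp add: eq_fract)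
qed

lemma polynomials_in_add: "p \<in> polynomials_in E \<Longrightarrow> q \<in> polynomials_in E \<Longrightarrow> p + q \<in> polynomials_in E"
  using Poly_Mapping.keys_add[of p q] by (fastforce simp: polynomials_in_def)

lemma polynomials_in_mult:
  assumes "p \<in> polynomials_in E" "q \<in> polynomials_in E"
  shows "p * q \<in> polynomials_in E"
  unfolding polynomials_in_def
proof (intro CollectI ballI)
  fix m assume "m \<in> Poly_Mapping.keys (p * q)"
  then obtain k l where kl: "m = k + l" "k \<in> Poly_Mapping.keys p" "l \<in> Poly_Mapping.keys q"
    using keys_mult[of p q] by blast
  with assms have "Poly_Mapping.keys k \<subseteq> set_encode ` E" "Poly_Mapping.keys l \<subseteq> set_encode ` E"
    by (auto simp: polynomials_in_def)
  with kl(1) Poly_Mapping.keys_add[of k l] show "Poly_Mapping.keys m \<subseteq> set_encode ` E" by auto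
qed

lemma one_in_polynomials_in: "1 \<in> polynomials_in E"
  by (simp add: polynomials_in_def)

lemma ratfuns_in_add:
  assumes "f \<in> ratfuns_in E" "g \<in> ratfuns_in E"
  shows "f + g \<in> ratfuns_in E"
proof -
  from assms obtain p q p' q' where "f = Fract p q" "g = Fract p' q'"
    "{p, q, p', q'} \<subseteq> polynomials_in E" "q \<noteq> 0" "q' \<noteq> 0"
    by (auto simp: ratfuns_in_def)
  then have "f + g = Fract (p * q' + p' * q) (q * q')" "p * q' + p' * q \<in> polynomials_in E"
    "q * q' \<in> polynomials_in E" "q * q' \<noteq> 0"
    by (auto intro: polynomials_in_add polynomials_in_mult)
  then show ?thesis unfolding ratfuns_in_def by blast
qed

lemma ratfuns_in_mult:
  assumes "f \<in> ratfuns_in E" "g \<in> ratfuns_in E"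
  shows "f * g \<in> ratfuns_in E"
proof -
  from assms obtain p q p' q' where "f = Fract p q" "g = Fract p' q'"
    "{p, q, p', q'} \<subseteq> polynomials_in E" "q \<noteq> 0" "q' \<noteq> 0"
    by (auto simp: ratfuns_in_def)
  then have "f * g = Fract (p * p') (q * q')" "p * p' \<in> polynomials_in E"
    "q * q' \<in> polynomials_in E" "q * q' \<noteq> 0"
    by (auto intro: polynomials_in_mult)
  then show ?thesis unfolding ratfuns_in_def by blast
qed

lemma indet_in_ratfuns_in:
  assumes "e \<in> E"
  shows "indet e \<in> ratfuns_in E" "inverse (indet e) \<in> ratfuns_in E"
proof -
  define X :: polynomial where "X = Poly_Mapping.single (Poly_Mapping.single (set_encode e) 1) 1"
  have X: "indet e = Fract X 1" by (simp add: indet_def X_def)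
  have "X \<noteq> 0" using indet_nonzero[of e] X by (auto simp: fract_collapse)
  moreover have "X \<in> polynomials_in E"
    using assms by (simp add: X_def polynomials_in_def)
  ultimately show "indet e \<in> ratfuns_in E" "inverse (indet e) \<in> ratfuns_in E"
    using one_in_polynomials_in[of E] unfolding X ratfuns_in_def by fastforce+
qed

section \<open>Arithmetic of positive Laurent polynomials\<close>

lemma const_0: "const 0 = 0"
  by (simp add: const_def fract_collapse)

lemma const_1: "const 1 = 1"
  by (simp add: const_def One_fract_def)

lemma const_add: "const (c + d) = const c + const d"
  by (simp add: const_def single_add)

lemma const_mult: "const (c * d) = const c * const d"
  by (simp add: const_def mult_single)

definition laurent_monomial :: "(nat set \<Rightarrow>\<^sub>0 int) \<Rightarrow> ratfun" where
  "laurent_monomial a = (\<Prod>e\<in>Poly_Mapping.keys a. indet e powi Poly_Mapping.lookup a e)"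

text \<open>Additional indices carry exponent 0 and contribute the factor 1. This provides a common
  index set for two monomials, even when exponents cancel in their product.\<close>

lemma laurent_monomial_superset:
  assumes "finite A" "Poly_Mapping.keys a \<subseteq> A"
  shows "laurent_monomial a = (\<Prod>e\<in>A. indet e powi Poly_Mapping.lookup a e)"
  unfolding laurent_monomial_def using assms
  by (intro prod.mono_neutral_left) (auto simp: in_keys_iff)

lemma laurent_monomial_add:
  "laurent_monomial (a + b) = laurent_monomial a * laurent_monomial b"
proof -
  let ?A = "Poly_Mapping.keys a \<union> Poly_Mapping.keys b"
  have "laurent_monomial (a + b) = (\<Prod>e\<in>?A. indet e powi Poly_Mapping.lookup (a + b) e)"
    using Poly_Mapping.keys_add[of a b] by (intro laurent_monomial_superset) auto
  also have "\<dots> = (\<Prod>e\<in>?A. indet e powi Poly_Mapping.lookup a e) *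
      (\<Prod>e\<in>?A. indet e powi Poly_Mapping.lookup b e)"
    by (simp add: lookup_add power_int_add indet_nonzero prod.distrib)
  also have "\<dots> = laurent_monomial a * laurent_monomial b"
    by (simp add: laurent_monomial_superset[of ?A])
  finally show ?thesis .
qed

lemma positive_laurent_iff:
  "positive_laurent E f \<longleftrightarrow> (\<exists>L :: (nat set \<Rightarrow>\<^sub>0 int) \<Rightarrow>\<^sub>0 rat.
     (\<forall>a\<in>Poly_Mapping.keys L. Poly_Mapping.keys a \<subseteq> E \<and> Poly_Mapping.lookup L a > 0) \<and>
     f = (\<Sum>a\<in>Poly_Mapping.keys L. const (Poly_Mapping.lookup L a) * laurent_monomial a))"
  by (simp add: positive_laurent_def laurent_monomial_def)

lemma positive_laurent_0: "positive_laurent E 0"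
  unfolding positive_laurent_iff by (rule exI[of _ 0]) simp

lemma positive_laurent_monomial:
  assumes "c > 0" "Poly_Mapping.keys a \<subseteq> E"
  shows "positive_laurent E (const c * laurent_monomial a)"
  unfolding positive_laurent_iff using assms
  by (intro exI[of _ "Poly_Mapping.single a c"]) simp

lemma positive_laurent_add:
  assumes "positive_laurent E f" "positive_laurent E g"
  shows "positive_laurent E (f + g)"
proof -
  \<comment> \<open>The explicit index set \<open>A\<close> allows both sums to run over the union
    of the supports, where missing coefficients are 0.\<close>
  define ev where "ev A L = (\<Sum>a\<in>A. const (Poly_Mapping.lookup L a) * laurent_monomial a)"
    for A and L :: "(nat set \<Rightarrow>\<^sub>0 int) \<Rightarrow>\<^sub>0 rat"
  have ev_superset: "ev (Poly_Mapping.keys L) L = ev A L"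
    if "finite A" "Poly_Mapping.keys L \<subseteq> A" for A L
    unfolding ev_def using that
    by (intro sum.mono_neutral_left) (auto simp: in_keys_iff const_0)
  from assms(1) obtain L where
    L: "\<forall>a\<in>Poly_Mapping.keys L. Poly_Mapping.keys a \<subseteq> E \<and> Poly_Mapping.lookup L a > 0"
      "f = ev (Poly_Mapping.keys L) L"
    unfolding positive_laurent_iff ev_def by blast
  from assms(2) obtain K where
    K: "\<forall>a\<in>Poly_Mapping.keys K. Poly_Mapping.keys a \<subseteq> E \<and> Poly_Mapping.lookup K a > 0"
      "g = ev (Poly_Mapping.keys K) K"
    unfolding positive_laurent_iff ev_def by blast
  let ?A = "Poly_Mapping.keys L \<union> Poly_Mapping.keys K"
  have sub: "Poly_Mapping.keys (L + K) \<subseteq> ?A" by (rule Poly_Mapping.keys_add)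
  have "f + g = ev ?A L + ev ?A K"
    using L(2) K(2) by (simp add: ev_superset[of ?A])
  also have "\<dots> = ev ?A (L + K)"
    by (simp add: ev_def lookup_add const_add algebra_simps sum.distrib)
  also have "\<dots> = ev (Poly_Mapping.keys (L + K)) (L + K)"
    using sub by (simp add: ev_superset[of ?A])
  finally have "f + g = ev (Poly_Mapping.keys (L + K)) (L + K)" .
  moreover have "Poly_Mapping.keys a \<subseteq> E \<and> Poly_Mapping.lookup (L + K) a > 0"
    if "a \<in> Poly_Mapping.keys (L + K)" for a
  proof -
    \<comment> \<open>Coefficients are positive on the support and 0 off it, so a nonzero sum of two
      of them is positive.\<close>
    have nonneg: "Poly_Mapping.lookup L a \<ge> 0" "Poly_Mapping.lookup K a \<ge> 0"
      using L(1) K(1) by (metis in_keys_iff less_imp_le order_refl)+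
    moreover have "Poly_Mapping.lookup (L + K) a \<noteq> 0" using that by (simp add: in_keys_iff)
    ultimately have "Poly_Mapping.lookup (L + K) a > 0" by (simp add: lookup_add)
    with that sub L(1) K(1) show ?thesis by blast
  qed
  ultimately show ?thesis unfolding positive_laurent_iff ev_def by blast
qed

lemma positive_laurent_sum:
  assumes "\<And>a. a \<in> A \<Longrightarrow> positive_laurent E (f a)"
  shows "positive_laurent E (\<Sum>a\<in>A. f a)"
  using assms
  by (induction A rule: infinite_finite_induct) (auto intro: positive_laurent_0 positive_laurent_add)

text \<open>Expanding into a double sum of positive monomials avoids computing the coefficients of
  the product; coinciding exponents \<open>a + b\<close> are merged by
  \<open>positive_laurent_sum\<close>.\<close>

lemma positive_laurent_mult:
  assumes "positive_laurent E f" "positive_laurent E g"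
  shows "positive_laurent E (f * g)"
proof -
  from assms(1) obtain L where
    L: "\<forall>a\<in>Poly_Mapping.keys L. Poly_Mapping.keys a \<subseteq> E \<and> Poly_Mapping.lookup L a > 0"
      "f = (\<Sum>a\<in>Poly_Mapping.keys L. const (Poly_Mapping.lookup L a) * laurent_monomial a)"
    unfolding positive_laurent_iff by blast
  from assms(2) obtain K where
    K: "\<forall>a\<in>Poly_Mapping.keys K. Poly_Mapping.keys a \<subseteq> E \<and> Poly_Mapping.lookup K a > 0"
      "g = (\<Sum>a\<in>Poly_Mapping.keys K. const (Poly_Mapping.lookup K a) * laurent_monomial a)"
    unfolding positive_laurent_iff by blast
  have "f * g = (\<Sum>a\<in>Poly_Mapping.keys L. \<Sum>b\<in>Poly_Mapping.keys K.
      const (Poly_Mapping.lookup L a * Poly_Mapping.lookup K b) * laurent_monomial (a + b))"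
    unfolding L(2) K(2) sum_product const_mult laurent_monomial_add
    by (simp add: algebra_simps)
  moreover have "Poly_Mapping.keys (a + b) \<subseteq> E"
    if "a \<in> Poly_Mapping.keys L" "b \<in> Poly_Mapping.keys K" for a b
    using that L(1) K(1) Poly_Mapping.keys_add[of a b] by blast
  ultimately show ?thesis
    using L(1) K(1) by (auto intro!: positive_laurent_sum positive_laurent_monomial)
qed

lemma positive_laurent_indet:
  assumes "e \<in> E"
  shows "positive_laurent E (indet e)" "positive_laurent E (inverse (indet e))"
proof -
  \<comment> \<open>A nonzero \<open>k\<close> makes \<open>e\<close> the sole key of the exponent
    vector, so the monomial is a single factor; the cases 1 and -1 are used.\<close>
  have "positive_laurent E (indet e powi k)" if "k \<noteq> 0" for k
  proof -
    have "positive_laurent E (const 1 * laurent_monomial (Poly_Mapping.single e k))"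
      using assms by (intro positive_laurent_monomial) auto
    with that show ?thesis by (simp add: const_1 laurent_monomial_def)
  qed
  from this[of 1] this[of "- 1"]
  show "positive_laurent E (indet e)" "positive_laurent E (inverse (indet e))"
    by (auto simp: power_int_minus)
qed

section \<open>The assignment of rational functions to the chords\<close>

context triangulated_polygon
begin

lemma assignment_iff:
  "ptolemy_assignment n T M \<longleftrightarrow>
     M \<in> chords n \<rightarrow>\<^sub>E ratfuns_in E \<and> (\<forall>e\<in>E. M e = indet e) \<and> ptolemy M"
  by (simp add: ptolemy_assignment_def ptolemy_def)

lemma assignment_exists: "\<exists>M. ptolemy_assignment n T M"
proof -
  obtain M :: "nat set \<Rightarrow> ratfun" where M: "ptolemy M" "\<And>e. e \<in> E \<Longrightarrow> M e = indet e"
    using ptolemy_exists[of indet] indet_nonzero by metis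
  \<comment> \<open>Restriction makes the assignment extensional; the relations survive because all
    pairs occurring in them are chords.\<close>
  define N where "N = restrict M (chords n)"
  have "M d \<in> ratfuns_in E" if "d \<in> chords n" for d
    by (rule ptolemy_closed[OF M(1) _ _ _ ratfuns_in_add ratfuns_in_mult that])
      (auto simp: M(2) indet_nonzero indet_in_ratfuns_in)
  then have "N \<in> chords n \<rightarrow>\<^sub>E ratfuns_in E" by (simp add: N_def)
  moreover have "\<forall>e\<in>E. N e = indet e"
    using M(2) edges_subset_chords by (auto simp: N_def)
  moreover have "ptolemy N"
  proof -
    have "{{i, j}, {k, l}, {j, k}, {i, l}, {i, k}, {j, l}} \<subseteq> chords n" if "cyclic_order n i j k l" for i j k l
      using that by (auto simp: cyclic_order_def intro!: pair_in_chords)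
    with M(1) show ?thesis by (simp add: ptolemy_def N_def)
  qed
  ultimately show ?thesis unfolding assignment_iff by blast
qed

lemma assignment_unique:
  assumes "ptolemy_assignment n T M" "ptolemy_assignment n T N"
  shows "M = N"
proof (rule PiE_ext)
  show "M \<in> chords n \<rightarrow>\<^sub>E ratfuns_in E" "N \<in> chords n \<rightarrow>\<^sub>E ratfuns_in E"
    using assms by (simp_all add: assignment_iff)
  show "M d = N d" if "d \<in> chords n" for d
    by (rule ptolemy_unique[OF _ _ _ _ that]) (use assms in \<open>simp_all add: assignment_iff indet_nonzero\<close>)
qed

lemma assignment_positive:
  assumes "ptolemy_assignment n T M" "d \<in> chords n"
  shows "positive_laurent E (M d)"
proof -
  \<comment> \<open>Positivity is \<open>ptolemy_closed\<close> with \<open>A\<close> the set of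
    positive Laurent polynomials.\<close>
  have "M d \<in> Collect (positive_laurent E)"
    by (rule ptolemy_closed[OF _ _ _ _ _ _ assms(2)])
      (use assms(1) in \<open>auto simp: assignment_iff indet_nonzero
        intro: positive_laurent_indet positive_laurent_add positive_laurent_mult\<close>)
  then show ?thesis by simp
qed

end

theorem theorem3p2:
  fixes n :: nat and T :: "nat set set"
  assumes "n \<ge> 3" and "triangulation n T"
  shows "(\<exists>!M. ptolemy_assignment n T M) \<and>
    (\<forall>M. ptolemy_assignment n T M \<longrightarrow>
      (\<forall>d\<in>diagonals n. positive_laurent (triangulation_edges n T) (M d)))"
proof -
  interpret triangulated_polygon n T
    using assms by unfold_locales
  show ?thesis
    using assignment_exists assignment_unique assignment_positive unfolding diagonals_def by blast
qed

end
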